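(* Let $\mathcal H$ be a real or complex separable Hilbert space of infinite dimension, and let $B$ be any bounded positive invertible operator on $\mathcal H$. Let $\{a_i\}_{i=1}^\infty$ be an arbitrary sequence of positive numbers with $\sum_{i=1}^\infty a_i^2 = \infty$ and with $\sup_i a_i^2 < \|B\|_{ess}$. Then there is a frame $\{z_i\}_{i=1}^\infty$ for $\mathcal H$ with frame operator $B$ such that $\|z_i\| = a_i$ for all $i$.
   Context: "Positive operator" means a bounded self-adjoint operator $B$ with $\langle Bx, x\rangle \geq 0$ for all $x \in \mathcal H$. The essential norm of a bounded operator $B$ on $\mathcal H$ is $\|B\|_{ess} = \inf\{\|B-K\| : K \text{ a compact operator on } \mathcal H\}$. A (countable) collection of vectors $\{z_i\} \subset \mathcal H$ is a frame for $\mathcal H$ if there exist constants $D \geq C > 0$ such that for every $x \in \mathcal H$, $C\|x\|^2 \leq \sum_i |\langle x, z_i\rangle|^2 \leq D\|x\|^2$. The vectors of a frame are indexed and need not be distinct. The frame operator of a frame $\{z_i\}$ is the map $S : \mathcal H \to \mathcal H$, $Sx = \sum_i \langle x, z_i\rangle z_i$. *)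

theory Defs
  imports "HOL-Analysis.Analysis"
begin

section \<open>Real or complex scalars\<close>

text \<open>
  The two scalar fields are treated uniformly by a type class. Its instances are \<^typ>\<open>real\<close> (with trivial
  conjugation) and \<^typ>\<open>complex\<close> (with complex conjugation). The axioms admit nothing else, see
  \<open>real_or_complex_cases\<close> below.
\<close>

class real_or_complex = real_normed_field +
  fixes scalar_conj :: "'a \<Rightarrow> 'a"
  assumes scalar_conj_add: "scalar_conj (x + y) = scalar_conj x + scalar_conj y"
    and scalar_conj_mult: "scalar_conj (x * y) = scalar_conj x * scalar_conj y"
    and mult_scalar_conj_scaleR: "x * scalar_conj x = (norm x)\<^sup>2 *\<^sub>R 1"

instantiation real :: real_or_complex
begin
definition scalar_conj_real :: "real \<Rightarrow> real" where "scalar_conj_real x = x"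
instance by standard (simp_all add: scalar_conj_real_def power2_eq_square algebra_simps)
end

instantiation complex :: real_or_complex
begin
definition scalar_conj_complex :: "complex \<Rightarrow> complex" where "scalar_conj_complex = cnj"
instance by standard (simp_all add: scalar_conj_complex_def complex_norm_square scaleR_conv_of_real del: of_real_power)
end

lemma mult_scalar_conj: "x * scalar_conj x = of_real ((norm x)\<^sup>2)" for x :: "'k::real_or_complex"
  by (simp only: mult_scalar_conj_scaleR of_real_def)

lemma real_or_complex_quadratic:
  fixes x :: "'k::real_or_complex"
  shows "\<exists>p q. (x - of_real p)\<^sup>2 = of_real q"
proof -
  define r where "r = (norm (1 + x))\<^sup>2 - 1 - (norm x)\<^sup>2"
  have one: "scalar_conj (1::'k) = 1"
    using mult_scalar_conj[of "1::'k"] by simp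
  have "(1 + x) * scalar_conj (1 + x) = of_real ((norm (1 + x))\<^sup>2)"
    by (rule mult_scalar_conj)
  moreover have "(1 + x) * scalar_conj (1 + x) = 1 + x + scalar_conj x + of_real ((norm x)\<^sup>2)"
    using mult_scalar_conj[of x] by (simp add: scalar_conj_add one algebra_simps)
  ultimately have "x + scalar_conj x = of_real r"
    by (simp add: r_def algebra_simps)
  then have c: "scalar_conj x = of_real r - x"
    by (simp add: algebra_simps)
  have "x * (of_real r - x) = of_real ((norm x)\<^sup>2)"
    using mult_scalar_conj[of x] by (simp only: c)
  then have "x\<^sup>2 = of_real r * x - of_real ((norm x)\<^sup>2)"
    by (simp add: algebra_simps power2_eq_square)
  then have "(x - of_real (r / 2))\<^sup>2 = of_real ((r / 2)\<^sup>2 - (norm x)\<^sup>2)"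
    by (simp add: power2_diff)
  then show ?thesis by blast
qed

lemma real_or_complex_cases:
  "(\<forall>x::'k::real_or_complex. x \<in> \<real>) \<or>
   (\<exists>j::'k. j\<^sup>2 = - 1 \<and> (\<forall>x. \<exists>s t. x = of_real s + of_real t * j))"
proof -
  have sq: "y \<in> \<real> \<or> (\<exists>t>0. (y / of_real t)\<^sup>2 = - 1)" if "y\<^sup>2 = of_real q" for y :: 'k and q
  proof (cases "q \<ge> 0")
    case True
    then have "y\<^sup>2 = (of_real (sqrt q))\<^sup>2"
      using that by (simp flip: of_real_power)
    then show ?thesis by (auto simp: power2_eq_iff)
  next
    case False
    then have "(y / of_real (sqrt (- q)))\<^sup>2 = - 1"
      using that by (simp add: power_divide flip: of_real_power)
    then show ?thesis using False by (intro disjI2 exI[of _ "sqrt (- q)"]) auto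
  qed
  show ?thesis
  proof (cases "\<exists>i::'k. i\<^sup>2 = - 1")
    case False
    have "x \<in> \<real>" for x :: 'k
    proof -
      obtain p q where "(x - of_real p)\<^sup>2 = of_real q"
        using real_or_complex_quadratic by blast
      then have "x - of_real p \<in> \<real>" using sq False by blast
      then show ?thesis by (metis Reals_add Reals_of_real diff_add_cancel)
    qed
    then show ?thesis by blast
  next
    case True
    then obtain i :: 'k where i: "i\<^sup>2 = - 1" by blast
    have "\<exists>s t. x = of_real s + of_real t * i" for x :: 'k
    proof -
      obtain p q where "(x - of_real p)\<^sup>2 = of_real q"
        using real_or_complex_quadratic by blast
      from sq[OF this] show ?thesis
      proof
        assume "x - of_real p \<in> \<real>"
        then obtain s where "x - of_real p = of_real s" by (auto elim: Reals_cases)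
        then have "x = of_real (p + s) + of_real 0 * i" by (simp add: algebra_simps)
        then show ?thesis by blast
      next
        assume "\<exists>t>0. ((x - of_real p) / of_real t)\<^sup>2 = - 1"
        then obtain t where t: "t > 0" "((x - of_real p) / of_real t)\<^sup>2 = i\<^sup>2"
          using i by auto
        then have "(x - of_real p) / of_real t = i \<or> (x - of_real p) / of_real t = - i"
          by (simp only: power2_eq_iff)
        then have "x = of_real p + of_real t * i \<or> x = of_real p + of_real (- t) * i"
          using t(1) by (auto simp: field_simps)
        then show ?thesis by blast
      qed
    qed
    then show ?thesis using i by blast
  qed
qed


section \<open>Hilbert spaces\<close>

text \<open>
  A Hilbert space over \<open>'k\<close> lives on a type \<open>'v\<close> of class \<^class>\<open>banach\<close>, which supplies the norm, the
  topology and completeness. The inner product is linear in its first argument and induces the norm.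
\<close>

locale hilbert_space = vector_space scl
  for scl :: "'k::real_or_complex \<Rightarrow> 'v::banach \<Rightarrow> 'v" +
  fixes ip :: "'v \<Rightarrow> 'v \<Rightarrow> 'k"
  assumes scale_of_real: "scl (of_real r) x = r *\<^sub>R x"
    and ip_add_left: "ip (x + y) z = ip x z + ip y z"
    and ip_scale_left: "ip (scl c x) y = c * ip x y"
    and ip_commute: "ip y x = scalar_conj (ip x y)"
    and ip_self: "ip x x = of_real ((norm x)\<^sup>2)"

lemma hilbert_space_real:
  "hilbert_space scaleR (inner :: 'v::{real_inner,banach} \<Rightarrow> 'v \<Rightarrow> real)"
  by unfold_locales
    (simp_all add: algebra_simps inner_add_left scalar_conj_real_def inner_commute power2_norm_eq_inner)

definition infinite_dimensional :: "('k::field \<Rightarrow> 'v::ab_group_add \<Rightarrow> 'v) \<Rightarrow> bool" where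
  "infinite_dimensional scl \<longleftrightarrow> \<not> (\<exists>S. finite S \<and> module.span scl S = UNIV)"


section \<open>Operators\<close>

definition bounded_operator :: "('k::real_or_complex \<Rightarrow> 'v::banach \<Rightarrow> 'v) \<Rightarrow> ('v \<Rightarrow> 'v) \<Rightarrow> bool" where
  "bounded_operator scl T \<longleftrightarrow> bounded_linear T \<and> (\<forall>c x. T (scl c x) = scl c (T x))"

definition compact_operator :: "('k::real_or_complex \<Rightarrow> 'v::banach \<Rightarrow> 'v) \<Rightarrow> ('v \<Rightarrow> 'v) \<Rightarrow> bool" where
  "compact_operator scl K \<longleftrightarrow> bounded_operator scl K \<and> compact (closure (K ` cball 0 1))"

definition invertible_operator :: "('k::real_or_complex \<Rightarrow> 'v::banach \<Rightarrow> 'v) \<Rightarrow> ('v \<Rightarrow> 'v) \<Rightarrow> bool" where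
  "invertible_operator scl T \<longleftrightarrow>
     bounded_operator scl T \<and> (\<exists>R. bounded_operator scl R \<and> R \<circ> T = id \<and> T \<circ> R = id)"

definition positive_operator ::
  "('k::real_or_complex \<Rightarrow> 'v::banach \<Rightarrow> 'v) \<Rightarrow> ('v \<Rightarrow> 'v \<Rightarrow> 'k) \<Rightarrow> ('v \<Rightarrow> 'v) \<Rightarrow> bool" where
  "positive_operator scl ip T \<longleftrightarrow>
     bounded_operator scl T \<and>
     (\<forall>x y. ip (T x) y = ip x (T y)) \<and>
     (\<forall>x. \<exists>r\<ge>0. ip (T x) x = of_real r)"

definition essential_norm :: "('k::real_or_complex \<Rightarrow> 'v::banach \<Rightarrow> 'v) \<Rightarrow> ('v \<Rightarrow> 'v) \<Rightarrow> real" where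
  "essential_norm scl T = Inf {onorm (\<lambda>x. T x - K x) | K. compact_operator scl K}"


section \<open>Frames\<close>

text \<open>Summability is required explicitly because the real \<^const>\<open>suminf\<close> of a divergent series is arbitrary.\<close>

definition is_frame :: "('v::banach \<Rightarrow> 'v \<Rightarrow> 'k::real_or_complex) \<Rightarrow> (nat \<Rightarrow> 'v) \<Rightarrow> bool" where
  "is_frame ip z \<longleftrightarrow>
     (\<exists>C D. 0 < C \<and> C \<le> D \<and>
       (\<forall>x. summable (\<lambda>i. (norm (ip x (z i)))\<^sup>2) \<and>
            C * (norm x)\<^sup>2 \<le> (\<Sum>i. (norm (ip x (z i)))\<^sup>2) \<and>
            (\<Sum>i. (norm (ip x (z i)))\<^sup>2) \<le> D * (norm x)\<^sup>2))"

definition has_frame_operator ::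
  "('k::real_or_complex \<Rightarrow> 'v::banach \<Rightarrow> 'v) \<Rightarrow> ('v \<Rightarrow> 'v \<Rightarrow> 'k) \<Rightarrow> (nat \<Rightarrow> 'v) \<Rightarrow> ('v \<Rightarrow> 'v) \<Rightarrow> bool" where
  "has_frame_operator scl ip z S \<longleftrightarrow> (\<forall>x. (\<lambda>i. scl (ip x (z i)) (z i)) sums S x)"

end

theory Submission
  imports Defs
begin

text \<open>
  Having frame operator \<open>B\<close> means that \<open>B\<close> is the strong sum of the rank-one operators
  \<open>z\<^sub>i z\<^sub>i\<^sup>*\<close>, so \<open>B\<close> has to be split into such pieces with prescribed
  \<open>\<parallel>z\<^sub>i\<parallel>\<^sup>2 = \<alpha>\<^sub>i\<close>, where \<open>\<alpha>\<^sub>i = a\<^sub>i\<^sup>2\<close>. The pieces are subtracted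
  one at a time, keeping the residual \<open>A\<close> positive. The Cauchy-Schwarz inequality for the form
  \<open>\<langle>A x, x\<rangle>\<close> shows that \<open>u = A e / \<langle>A e, e\<rangle>\<^sup>1\<^sup>/\<^sup>2\<close> satisfies \<open>u u\<^sup>* \<le> A\<close> and that
  \<open>A - u u\<^sup>*\<close> annihilates \<open>e\<close>; but the norm of \<open>u\<close> is dictated by \<open>A\<close> and \<open>e\<close>.

  If \<open>u\<close> is too long, a shorter multiple of it is subtracted. If \<open>u\<close> is too short, it is
  lengthened with the help of the essential norm. Fix \<open>s < \<beta> < \<parallel>B\<parallel>\<^sub>e\<^sub>s\<^sub>s\<close> with
  \<open>\<alpha>\<^sub>i \<le> s\<close>. Finite-rank perturbations do not change the essential norm, so
  \<open>A - u u\<^sup>*\<close> must still stretch some vector of any given hyperplane by more than \<open>\<beta>\<close>;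
  this yields \<open>v\<close> orthogonal to \<open>u\<close> with \<open>u u\<^sup>* + v v\<^sup>* \<le> A\<close> and
  \<open>\<parallel>v\<parallel>\<^sup>2 > \<beta>\<close>. A unit combination \<open>z = cos \<theta> u + sin \<theta> v\<close> then has the required
  norm, and \<open>z z\<^sup>* \<le> u u\<^sup>* + v v\<^sup>* \<le> A\<close>. Since \<open>\<beta>\<close> exceeds \<open>s\<close>, the weight of
  \<open>u\<close> in \<open>z\<close> stays away from zero. In both cases the step for \<open>\<alpha>\<^sub>i\<close> multiplies
  \<open>\<langle>A e, e\<rangle>\<close> by at most \<open>1 - c \<alpha>\<^sub>i\<close>, with \<open>c > 0\<close> the same at every step
  (\<open>extraction_step\<close>).

  Take \<open>e\<close> from a dense sequence, and distribute the steps so that every member \<open>e\<^sub>j\<close> receives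
  a divergent share of \<open>\<Sum> \<alpha>\<^sub>i\<close> (\<open>not_summable_split\<close>). Then
  \<open>\<langle>A e\<^sub>j, e\<^sub>j\<rangle>\<close> tends to \<open>0\<close> along the residuals, hence so does \<open>A e\<^sub>j\<close>, and the uniform bound
  on the residuals extends this to all vectors: the pieces add up to \<open>B\<close>
  (\<open>rank_one_decomposition\<close>). The frame bounds express only that \<open>\<langle>B x, x\<rangle>\<close> is
  comparable with \<open>\<parallel>x\<parallel>\<^sup>2\<close>, which is the boundedness and invertibility of \<open>B\<close>.
\<close>

section \<open>The scalar field\<close>

lemma scalar_conj_of_real [simp]: "scalar_conj (of_real r :: 'k::real_or_complex) = of_real r"
proof (cases "r = 0")
  case True
  have "scalar_conj (0::'k) + scalar_conj 0 = scalar_conj 0"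
    using scalar_conj_add[of "0::'k" 0] by simp
  then show ?thesis using True by simp
next
  case False
  have "of_real r * scalar_conj (of_real r) = of_real r * (of_real r :: 'k)"
    using mult_scalar_conj[of "of_real r :: 'k"] by (simp add: power2_eq_square)
  then show ?thesis using False by simp
qed

lemma scalar_conj_0 [simp]: "scalar_conj (0::'k::real_or_complex) = 0"
  using scalar_conj_of_real[of 0, where 'k = 'k] by simp

text \<open>The axioms force \<open>scalar_conj j = - j\<close>, because \<open>j\<close> has norm \<open>1\<close> and inverse \<open>- j\<close>.\<close>

lemma norm_of_real_add_imaginary:
  fixes j :: "'k::real_or_complex"
  assumes "j\<^sup>2 = - 1"
  shows "(norm (of_real s + of_real t * j))\<^sup>2 = s\<^sup>2 + t\<^sup>2"
proof -
  have "(norm j)\<^sup>2 = 1" using arg_cong[OF assms, of norm] by (simp add: norm_power)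
  then have "j * scalar_conj j = j * (- j)"
    using mult_scalar_conj[of j] assms by (simp add: power2_eq_square)
  moreover have "j \<noteq> 0" using assms by auto
  ultimately have j: "scalar_conj j = - j" by (metis mult_left_cancel)
  have "(of_real ((norm (of_real s + of_real t * j))\<^sup>2) :: 'k)
      = (of_real s + of_real t * j) * (of_real s - of_real t * j)"
    by (simp only: mult_scalar_conj[symmetric] scalar_conj_add scalar_conj_mult
        scalar_conj_of_real j) (simp add: algebra_simps)
  also have "\<dots> = of_real (s\<^sup>2) - of_real (t\<^sup>2) * j\<^sup>2"
    by (simp add: algebra_simps power2_eq_square)
  also have "\<dots> = of_real (s\<^sup>2 + t\<^sup>2)" using assms by simp
  finally show ?thesis by (simp only: of_real_eq_iff)
qed

text \<open>
  The class does not provide the Heine-Borel property; it holds because the field is the image of the real line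
  or of the real plane under a continuous map that does not shrink coordinates. It is what makes rank-one
  operators compact.
\<close>

lemma compact_scalar_cball: "compact (cball (0::'k::real_or_complex) r)"
proof -
  have "\<exists>C. compact C \<and> cball (0::'k) r \<subseteq> C"
  proof (cases "\<forall>x::'k. x \<in> \<real>")
    case True
    have "compact ((of_real :: real \<Rightarrow> 'k) ` {-r..r})"
      by (intro compact_continuous_image continuous_intros) auto
    moreover have "cball (0::'k) r \<subseteq> of_real ` {-r..r}"
    proof
      fix x :: 'k assume "x \<in> cball 0 r"
      moreover obtain s where "x = of_real s" using True by (auto elim: Reals_cases)
      ultimately show "x \<in> of_real ` {-r..r}"
        by (intro image_eqI[of x of_real s]) (simp_all add: abs_le_iff)
    qed
    ultimately show ?thesis by blast
  next
    case False
    then obtain j :: 'k where j: "j\<^sup>2 = - 1" "\<And>x. \<exists>s t. x = of_real s + of_real t * j"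
      using real_or_complex_cases[where 'k = 'k] by blast
    let ?f = "\<lambda>p. of_real (fst p) + of_real (snd p) * j"
    have "compact (?f ` ({-r..r} \<times> {-r..r}))"
      by (intro compact_continuous_image continuous_intros compact_Times) auto
    moreover have "cball (0::'k) r \<subseteq> ?f ` ({-r..r} \<times> {-r..r})"
    proof
      fix x :: 'k assume x: "x \<in> cball 0 r"
      obtain s t where st: "x = of_real s + of_real t * j" using j(2) by blast
      have n: "(norm x)\<^sup>2 = s\<^sup>2 + t\<^sup>2" unfolding st by (rule norm_of_real_add_imaginary[OF j(1)])
      have "\<bar>s\<bar> \<le> norm x" by (rule power2_le_imp_le) (simp_all add: n)
      moreover have "\<bar>t\<bar> \<le> norm x" by (rule power2_le_imp_le) (simp_all add: n)
      moreover have "norm x \<le> r" using x by simp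
      ultimately have "(s, t) \<in> {-r..r} \<times> {-r..r}" by (simp add: abs_le_iff)
      moreover have "x = ?f (s, t)" using st by simp
      ultimately show "x \<in> ?f ` ({-r..r} \<times> {-r..r})" by (rule rev_image_eqI)
    qed
    ultimately show ?thesis by blast
  qed
  then show ?thesis
    by (metis closed_cball compact_Int_closed inf.absorb_iff2)
qed

section \<open>Inner products and quadratic forms of positive operators\<close>

context hilbert_space
begin

lemma ip_add_right: "ip x (y + z) = ip x y + ip x z"
  by (metis ip_add_left ip_commute scalar_conj_add)

lemma ip_scale_right: "ip x (scl c y) = scalar_conj c * ip x y"
  by (metis ip_scale_left ip_commute scalar_conj_mult)

lemma ip_scaleR_left: "ip (r *\<^sub>R x) y = of_real r * ip x y"
  by (simp only: scale_of_real[symmetric] ip_scale_left)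

lemma ip_scaleR_right: "ip x (r *\<^sub>R y) = of_real r * ip x y"
  by (simp only: scale_of_real[symmetric] ip_scale_right scalar_conj_of_real)

lemma ip_diff_left: "ip (x - y) z = ip x z - ip y z"
  using ip_add_left[of "x - y" y z] by simp

lemma ip_zero_right [simp]: "ip x 0 = 0"
  using ip_add_right[of x 0 0] by simp

lemma ip_mult_commute: "ip x y * ip y x = of_real ((norm (ip x y))\<^sup>2)"
  by (metis ip_commute mult_scalar_conj)

lemma norm_scale: "norm (scl c x) = norm c * norm x"
proof -
  have "(of_real ((norm (scl c x))\<^sup>2) :: 'k) = (c * scalar_conj c) * of_real ((norm x)\<^sup>2)"
    by (simp only: ip_self[symmetric] ip_scale_left ip_scale_right mult.assoc mult.left_commute)
  also have "\<dots> = of_real ((norm c * norm x)\<^sup>2)"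
    by (simp add: mult_scalar_conj power_mult_distrib)
  finally have "(norm (scl c x))\<^sup>2 = (norm c * norm x)\<^sup>2" by (simp only: of_real_eq_iff)
  then show ?thesis by simp
qed

text \<open>The value of the quadratic form of a positive operator; the norm converts it to a real.\<close>

definition quad :: "('v \<Rightarrow> 'v) \<Rightarrow> 'v \<Rightarrow> real" where
  "quad A x = norm (ip (A x) x)"

lemma quad_nonneg [simp]: "0 \<le> quad A x"
  by (simp add: quad_def)

lemma ip_eq_quad: "positive_operator scl ip A \<Longrightarrow> ip (A x) x = of_real (quad A x)"
  unfolding positive_operator_def quad_def by (metis abs_of_nonneg norm_of_real)

lemma bounded_operator_id: "bounded_operator scl (\<lambda>x. x)"
  by (simp add: bounded_operator_def bounded_linear_ident)

lemma positive_operator_id: "positive_operator scl ip (\<lambda>x. x)"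
  unfolding positive_operator_def using ip_self by (auto simp: bounded_operator_id intro!: exI zero_le_power2)

lemma quad_id: "quad (\<lambda>x. x) x = (norm x)\<^sup>2"
  by (simp add: quad_def ip_self norm_power)

lemma positive_operatorD:
  assumes "positive_operator scl ip A"
  shows "bounded_linear A" "A (scl c x) = scl c (A x)" "ip (A x) y = ip x (A y)"
  using assms by (auto simp: positive_operator_def bounded_operator_def)

text \<open>
  A positive operator defines a semidefinite inner product \<open>\<langle>A x, y\<rangle>\<close>, for which the usual argument
  works: evaluate the form at \<open>x - r b y\<close>, where \<open>b = \<langle>A x, y\<rangle>\<close> and \<open>r\<close> is real.
\<close>

theorem Cauchy_Schwarz_quad:
  assumes A: "positive_operator scl ip A"
  shows "(norm (ip (A x) y))\<^sup>2 \<le> quad A x * quad A y"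
proof -
  define b where "b = ip (A x) y"
  note lin = positive_operatorD[OF A] bounded_linear.linear[OF positive_operatorD(1)[OF A]]
  have b': "ip (A y) x = scalar_conj b"
    unfolding b_def by (metis ip_commute lin(3))
  have key: "0 \<le> quad A x - 2 * r * (norm b)\<^sup>2 + r\<^sup>2 * (norm b)\<^sup>2 * quad A y" for r
  proof -
    define c where "c = of_real (- r) * b"
    define w where "w = x + scl c y"
    have cb: "c * scalar_conj b = of_real (- r * (norm b)\<^sup>2)"
      unfolding c_def mult.assoc mult_scalar_conj by simp
    have cb': "scalar_conj c * b = of_real (- r * (norm b)\<^sup>2)"
      unfolding c_def scalar_conj_mult scalar_conj_of_real mult.assoc
      using mult_scalar_conj[of b] by (simp add: mult.commute)
    have cc: "c * scalar_conj c = of_real (r\<^sup>2 * (norm b)\<^sup>2)"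
      unfolding mult_scalar_conj by (simp add: c_def norm_mult power_mult_distrib)
    have "ip (A w) w = ip (A x) x + scalar_conj c * b + c * ip (A y) x + c * scalar_conj c * ip (A y) y"
      unfolding w_def linear_add[OF lin(4)] lin(2) ip_add_left ip_add_right
        ip_scale_left ip_scale_right b_def by (simp add: algebra_simps)
    also have "\<dots> = of_real (quad A x - 2 * r * (norm b)\<^sup>2 + r\<^sup>2 * (norm b)\<^sup>2 * quad A y)"
      unfolding b' cb cb' cc ip_eq_quad[OF A] by (simp add: algebra_simps)
    finally show ?thesis
      unfolding ip_eq_quad[OF A] of_real_eq_iff by (metis quad_nonneg)
  qed
  show ?thesis
  proof (cases "quad A y = 0")
    case True
    have "(norm b)\<^sup>2 = 0"
    proof (rule ccontr)
      assume "(norm b)\<^sup>2 \<noteq> 0"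
      \<comment> \<open>The form is now affine in \<open>r\<close> with negative slope; this \<open>r\<close> makes it negative.\<close>
      then show False
        using key[of "(quad A x + 1) / (norm b)\<^sup>2"] True quad_nonneg[of A x] by simp
    qed
    then show ?thesis using True by (simp add: b_def)
  next
    case False
    then have y: "quad A y > 0" using quad_nonneg[of A y] by linarith
    \<comment> \<open>The minimum over \<open>r\<close>.\<close>
    have "0 \<le> quad A x - (norm b)\<^sup>2 / quad A y"
      using key[of "1 / quad A y"] y by (simp add: field_simps power2_eq_square)
    then show ?thesis using y by (simp add: field_simps b_def)
  qed
qed

lemma Cauchy_Schwarz: "norm (ip x y) \<le> norm x * norm y"
proof (rule power2_le_imp_le)
  show "(norm (ip x y))\<^sup>2 \<le> (norm x * norm y)\<^sup>2"
    using Cauchy_Schwarz_quad[OF positive_operator_id, of x y]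
    by (simp only: quad_id power_mult_distrib)
qed simp

text \<open>
  Cauchy-Schwarz with \<open>y = A x\<close>. Through this inequality, smallness of the quadratic form at a vector
  makes its image under \<open>A\<close> small.
\<close>

lemma norm_sq_le_quad:
  assumes A: "positive_operator scl ip A" and M: "\<And>x. quad A x \<le> M * (norm x)\<^sup>2"
  shows "(norm (A x))\<^sup>2 \<le> M * quad A x"
proof (cases "A x = 0")
  case True
  have "0 \<le> quad A x * M"
  proof (cases "x = 0")
    case False
    have "0 \<le> M" using order_trans[OF quad_nonneg M[of x]] False
      by (simp add: zero_le_mult_iff)
    then show ?thesis by simp
  qed (simp add: quad_def)
  then show ?thesis using True by (simp add: mult.commute)
next
  case False
  have "(norm (A x))\<^sup>2 * (norm (A x))\<^sup>2 = (norm (ip (A x) (A x)))\<^sup>2"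
    by (simp add: ip_self norm_mult power2_eq_square)
  also have "\<dots> \<le> quad A x * quad A (A x)" by (rule Cauchy_Schwarz_quad[OF A])
  also have "\<dots> \<le> quad A x * (M * (norm (A x))\<^sup>2)" by (intro mult_left_mono M) simp
  finally have "(norm (A x))\<^sup>2 * (norm (A x))\<^sup>2 \<le> (M * quad A x) * (norm (A x))\<^sup>2"
    by (simp add: mult_ac)
  then show ?thesis by (rule mult_right_le_imp_le) (use False in simp)
qed

lemma quad_bounded:
  assumes A: "positive_operator scl ip A"
  obtains M where "0 < M" "\<And>x. quad A x \<le> M * (norm x)\<^sup>2"
proof -
  obtain M where M: "0 < M" "\<And>x. norm (A x) \<le> norm x * M"
    using bounded_linear.pos_bounded[OF positive_operatorD(1)[OF A]] by blast
  have "quad A x \<le> M * (norm x)\<^sup>2" for x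
    using order_trans[OF Cauchy_Schwarz mult_right_mono[OF M(2)], of x x]
    by (simp add: quad_def power2_eq_square mult_ac)
  with M(1) show ?thesis by (rule that)
qed

section \<open>Rank-one operators\<close>

definition rank_one :: "'v \<Rightarrow> 'v \<Rightarrow> 'v \<Rightarrow> 'v" where
  "rank_one p q x = scl (ip x p) q"

lemma bounded_operator_rank_one: "bounded_operator scl (rank_one p q)"
  unfolding bounded_operator_def
proof (intro conjI allI)
  show "bounded_linear (rank_one p q)"
  proof (rule bounded_linear_intro[where K = "norm p * norm q"])
    show "norm (rank_one p q x) \<le> norm x * (norm p * norm q)" for x
      using mult_right_mono[OF Cauchy_Schwarz[of x p], of "norm q"]
      by (simp add: rank_one_def norm_scale mult.assoc)
    show "rank_one p q (r *\<^sub>R x) = r *\<^sub>R rank_one p q x" for r x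
      by (simp only: rank_one_def ip_scaleR_left scale_scale[symmetric] scale_of_real)
  qed (simp add: rank_one_def ip_add_left scale_left_distrib)
qed (simp add: rank_one_def ip_scale_left)

text \<open>
  The image of the unit ball lies in the sum of two compact sets, one of them a disk of scalars times \<open>q\<close>.
\<close>

lemma compact_operator_add_rank_one:
  assumes "compact_operator scl K"
  shows "compact_operator scl (\<lambda>x. K x + rank_one p q x)"
proof -
  let ?T = "\<lambda>x. K x + rank_one p q x"
  let ?D = "(\<lambda>c. scl c q) ` cball 0 (norm p)"
  let ?C = "{a + b | a b. a \<in> closure (K ` cball 0 1) \<and> b \<in> ?D}"
  have bo: "bounded_operator scl ?T"
    using assms bounded_operator_rank_one[of p q]
    by (auto simp: compact_operator_def bounded_operator_def scale_right_distrib
        intro: bounded_linear_add)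
  have "bounded_linear (\<lambda>c. scl c q)"
  proof (rule bounded_linear_intro[where K = "norm q"])
    show "scl (r *\<^sub>R c) q = r *\<^sub>R scl c q" for r c
      by (simp only: scaleR_conv_of_real[of r c] scale_scale[symmetric] scale_of_real)
  qed (simp_all add: scale_left_distrib norm_scale)
  then have "compact ?D"
    by (intro compact_continuous_image compact_scalar_cball linear_continuous_on)
  then have C: "compact ?C"
    using assms by (intro compact_sums) (auto simp: compact_operator_def)
  have "?T ` cball 0 1 \<subseteq> ?C"
  proof
    fix w assume "w \<in> ?T ` cball 0 1"
    then obtain x where x: "norm x \<le> 1" "w = K x + rank_one p q x" by auto
    have "norm (ip x p) \<le> norm p"
      using Cauchy_Schwarz[of x p] mult_right_mono[OF x(1), of "norm p"] by simp
    then have "rank_one p q x \<in> ?D"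
      unfolding rank_one_def by (intro imageI) simp
    moreover have "K x \<in> closure (K ` cball 0 1)"
      using x(1) by (intro closure_subset[THEN subsetD]) auto
    ultimately show "w \<in> ?C" using x(2) by blast
  qed
  then have "closure (?T ` cball 0 1) \<subseteq> ?C"
    using compact_imp_closed[OF C] by (rule closure_minimal)
  then have "?C \<inter> closure (?T ` cball 0 1) = closure (?T ` cball 0 1)"
    by (rule Int_absorb1)
  then have "compact (closure (?T ` cball 0 1))"
    using compact_Int_closed[OF C closed_closure[of "?T ` cball 0 1"]] by argo
  then show ?thesis using bo by (simp add: compact_operator_def)
qed

lemma compact_operator_zero: "compact_operator scl (\<lambda>x. 0)"
proof -
  have "(\<lambda>x. 0::'v) ` cball (0::'v) 1 = {0}" by (simp add: image_constant_conv)
  then show ?thesis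
    by (simp add: compact_operator_def bounded_operator_def)
qed

text \<open>The hypothesis \<open>le\<close> is the operator inequality \<open>z z\<^sup>* \<le> A\<close>, stated through quadratic forms.\<close>

lemma rank_one_le_imp_positive_diff:
  assumes A: "positive_operator scl ip A" and le: "\<And>x. (norm (ip x z))\<^sup>2 \<le> quad A x"
  shows "positive_operator scl ip (\<lambda>x. A x - rank_one z z x)"
    and "quad (\<lambda>x. A x - rank_one z z x) x = quad A x - (norm (ip x z))\<^sup>2"
proof -
  let ?T = "\<lambda>x. A x - rank_one z z x"
  have form: "ip (?T x) x = of_real (quad A x - (norm (ip x z))\<^sup>2)" for x
    unfolding ip_diff_left ip_eq_quad[OF A] rank_one_def ip_scale_left
    by (simp only: ip_mult_commute of_real_diff)
  have "bounded_operator scl ?T"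
    using A bounded_operator_rank_one[of z z]
    by (auto simp: positive_operator_def bounded_operator_def scale_right_diff_distrib
        intro: bounded_linear_sub)
  moreover have "ip (?T x) y = ip x (?T y)" for x y
  proof -
    have "ip x (?T y) = ip x (A y) - ip x (rank_one z z y)"
      using ip_add_right[of x "?T y" "rank_one z z y"] by simp
    also have "ip x (rank_one z z y) = ip x z * ip z y"
      by (simp add: rank_one_def ip_scale_right ip_commute[of z y, symmetric] mult.commute)
    finally show ?thesis
      by (simp add: ip_diff_left positive_operatorD(3)[OF A] rank_one_def ip_scale_left)
  qed
  moreover have "\<exists>r\<ge>0. ip (?T x) x = of_real r" for x
    using form le[of x] by (intro exI[of _ "quad A x - (norm (ip x z))\<^sup>2"]) simp
  ultimately show "positive_operator scl ip ?T" by (simp add: positive_operator_def)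
  show "quad ?T x = quad A x - (norm (ip x z))\<^sup>2"
    unfolding quad_def[of ?T] form norm_of_real using le[of x] by simp
qed

text \<open>
  For \<open>quad A y > 0\<close> this is the vector \<open>u\<close> for which \<open>u u\<^sup>* \<le> A\<close> and \<open>A - u u\<^sup>*\<close>
  annihilates \<open>y\<close>. For \<open>quad A y = 0\<close> division by zero makes it \<open>0\<close>, which has the same two properties.
\<close>

definition extracted_vector :: "('v \<Rightarrow> 'v) \<Rightarrow> 'v \<Rightarrow> 'v" where
  "extracted_vector A y = (1 / sqrt (quad A y)) *\<^sub>R A y"

lemma norm_ip_extracted_vector:
  "positive_operator scl ip A \<Longrightarrow>
    (norm (ip x (extracted_vector A y)))\<^sup>2 = (norm (ip (A x) y))\<^sup>2 / quad A y"
  by (simp add: extracted_vector_def ip_scaleR_right norm_mult norm_divide power_divide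
      positive_operatorD(3))

lemma extracted_vector_le:
  assumes A: "positive_operator scl ip A"
  shows "(norm (ip x (extracted_vector A y)))\<^sup>2 \<le> quad A x"
proof (cases "quad A y = 0")
  case False
  then have "0 < quad A y" using quad_nonneg[of A y] by linarith
  then show ?thesis
    unfolding norm_ip_extracted_vector[OF A] using Cauchy_Schwarz_quad[OF A, of x y]
    by (simp add: divide_le_eq)
qed (simp add: norm_ip_extracted_vector[OF A])

lemma extracted_vector_eq:
  assumes A: "positive_operator scl ip A"
  shows "(norm (ip y (extracted_vector A y)))\<^sup>2 = quad A y"
  unfolding norm_ip_extracted_vector[OF A] by (simp add: quad_def[symmetric] power2_eq_square)

lemma norm_extracted_vector: "(norm (extracted_vector A y))\<^sup>2 = (norm (A y))\<^sup>2 / quad A y"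
  by (simp add: extracted_vector_def power_mult_distrib power_divide)

section \<open>Long vectors from the essential norm\<close>

text \<open>
  For a number below the essential norm of \<open>A\<close> this holds by definition of the infimum. In this form the bound
  visibly survives compact perturbations and is convenient as an invariant.
\<close>

definition essentially_above :: "real \<Rightarrow> ('v \<Rightarrow> 'v) \<Rightarrow> bool" where
  "essentially_above \<beta> A \<longleftrightarrow> (\<forall>K. compact_operator scl K \<longrightarrow> \<beta> < onorm (\<lambda>x. A x - K x))"

lemma essentially_above_diff_rank_one:
  assumes "essentially_above \<beta> A"
  shows "essentially_above \<beta> (\<lambda>x. A x - rank_one p q x)"
  unfolding essentially_above_def
proof (intro allI impI)
  fix K assume "compact_operator scl K"
  then have "\<beta> < onorm (\<lambda>x. A x - (K x + rank_one p q x))"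
    using assms compact_operator_add_rank_one unfolding essentially_above_def by blast
  then show "\<beta> < onorm (\<lambda>x. A x - rank_one p q x - K x)" by (simp add: algebra_simps)
qed

text \<open>
  If \<open>A\<close> were bounded by \<open>\<beta>\<close> on the hyperplane orthogonal to \<open>w\<close>, then \<open>A P\<close> would have norm at most
  \<open>\<beta>\<close>, where \<open>P\<close> is the orthogonal projection onto it, although \<open>A - A P\<close> has rank one.
\<close>

lemma essentially_above_obtain:
  assumes A: "positive_operator scl ip A" and ess: "essentially_above \<beta> A" and "0 \<le> \<beta>"
  obtains y where "ip y w = 0" "\<beta> * norm y < norm (A y)"
proof -
  have "\<exists>y. ip y w = 0 \<and> \<beta> * norm y < norm (A y)"
  proof (rule ccontr)
    assume "\<not> ?thesis"
    then have neg: "norm (A y) \<le> \<beta> * norm y" if "ip y w = 0" for y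
      using that by force
    \<comment> \<open>For \<open>w = 0\<close> this gives \<open>q = 0\<close>, so that \<open>P\<close> is the identity, as it should be.\<close>
    define q where "q = (1 / (norm w)\<^sup>2) *\<^sub>R w"
    define P where "P x = x - rank_one w q x" for x
    let ?K = "rank_one w (A q)"
    have orth: "ip (P x) w = 0" for x
      by (cases "w = 0")
        (simp_all add: P_def q_def rank_one_def ip_diff_left ip_scale_left ip_scaleR_left ip_self)
    have Pn: "norm (P x) \<le> norm x" for x
    proof -
      have "ip (P x) (rank_one w q x) = 0"
        using orth[of x] by (simp add: rank_one_def q_def ip_scale_right ip_scaleR_right)
      then have "ip (P x) x = ip (P x) (P x)"
        using ip_add_right[of "P x" "P x" "rank_one w q x"] by (simp add: P_def)
      then have "norm (P x) * norm (P x) \<le> norm (P x) * norm x"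
        using Cauchy_Schwarz[of "P x" x] by (simp add: ip_self power2_eq_square norm_mult)
      then show ?thesis
        by (cases "P x = 0") (simp_all add: mult_le_cancel_left)
    qed
    have "A x - ?K x = A (P x)" for x
      unfolding P_def rank_one_def
      by (simp add: linear_diff[OF bounded_linear.linear[OF positive_operatorD(1)[OF A]]]
          positive_operatorD(2)[OF A])
    then have "norm (A x - ?K x) \<le> \<beta> * norm x" for x
      using order_trans[OF neg[OF orth] mult_left_mono[OF Pn \<open>0 \<le> \<beta>\<close>]] by simp
    then have "onorm (\<lambda>x. A x - ?K x) \<le> \<beta>" by (rule onorm_bound[OF \<open>0 \<le> \<beta>\<close>])
    moreover have "compact_operator scl ?K"
      using compact_operator_add_rank_one[OF compact_operator_zero, of w "A q"] by simp
    ultimately show False using ess unfolding essentially_above_def by (metis not_le)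
  qed
  then show ?thesis using that by blast
qed

text \<open>
  If \<open>A\<close> stretches \<open>y\<close> by more than \<open>\<beta>\<close>, then the vector \<open>v\<close> extracted at \<open>y\<close> satisfies
  \<open>\<parallel>v\<parallel>\<^sup>2 = \<parallel>A y\<parallel>\<^sup>2 / \<langle>A y, y\<rangle> \<ge> \<parallel>A y\<parallel> / \<parallel>y\<parallel> > \<beta>\<close>. It is
  parallel to \<open>A y\<close>, so taking \<open>y\<close> orthogonal to \<open>A u\<close> makes \<open>v\<close> orthogonal to \<open>u\<close>.
\<close>

lemma extract_long_vector:
  assumes A: "positive_operator scl ip A" and ess: "essentially_above \<beta> A" and "0 \<le> \<beta>"
  obtains v where "ip u v = 0" "\<beta> < (norm v)\<^sup>2" "\<And>x. (norm (ip x v))\<^sup>2 \<le> quad A x"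
proof -
  obtain y where y: "ip y (A u) = 0" "\<beta> * norm y < norm (A y)"
    using essentially_above_obtain[OF assms] .
  define v where "v = extracted_vector A y"
  have Ay: "norm (A y) > 0" using y(2) \<open>0 \<le> \<beta>\<close>
    by (meson le_less_trans mult_nonneg_nonneg norm_ge_zero)
  obtain M where "0 < M" and M: "\<And>x. quad A x \<le> M * (norm x)\<^sup>2"
    using quad_bounded[OF A] by blast
  have "(norm (A y))\<^sup>2 \<le> M * quad A y" by (rule norm_sq_le_quad[OF A M])
  then have "quad A y \<noteq> 0" using Ay by auto
  then have qy: "quad A y > 0" using quad_nonneg[of A y] by linarith
  have "\<beta> * quad A y \<le> \<beta> * (norm (A y) * norm y)"
    unfolding quad_def using Cauchy_Schwarz \<open>0 \<le> \<beta>\<close> by (rule mult_left_mono)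
  also have "\<dots> = norm (A y) * (\<beta> * norm y)" by simp
  also have "\<dots> < (norm (A y))\<^sup>2"
    using mult_strict_left_mono[OF y(2) Ay] by (simp add: power2_eq_square)
  finally have "\<beta> < (norm v)\<^sup>2"
    using qy by (simp add: v_def norm_extracted_vector field_simps)
  moreover have "ip u v = 0"
  proof -
    have "ip u (A y) = scalar_conj (ip y (A u))"
      by (metis ip_commute positive_operatorD(3)[OF A])
    then show ?thesis using y(1) by (simp add: v_def extracted_vector_def ip_scaleR_right)
  qed
  ultimately show ?thesis
    using that extracted_vector_le[OF A] unfolding v_def by blast
qed

section \<open>Extracting one rank-one piece of prescribed size\<close>

lemma norm_orthogonal_combination:
  assumes "ip u v = 0"
  shows "(norm (c *\<^sub>R u + d *\<^sub>R v))\<^sup>2 = c\<^sup>2 * (norm u)\<^sup>2 + d\<^sup>2 * (norm v)\<^sup>2"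
proof -
  have "ip v u = 0" using assms ip_commute[of v u] by simp
  then have "ip (c *\<^sub>R u + d *\<^sub>R v) (c *\<^sub>R u + d *\<^sub>R v)
      = of_real (c\<^sup>2 * (norm u)\<^sup>2 + d\<^sup>2 * (norm v)\<^sup>2)"
    using assms unfolding ip_add_left ip_add_right ip_scaleR_left ip_scaleR_right
    by (simp add: power2_eq_square ip_self[of u] ip_self[of v])
  then show ?thesis unfolding ip_self of_real_eq_iff .
qed

text \<open>
  With \<open>a = \<langle>x, u\<rangle>\<close> and \<open>b = \<langle>x, v\<rangle>\<close> this says that \<open>z z\<^sup>* \<le> u u\<^sup>* + v v\<^sup>*\<close> for the
  rotated vector \<open>z = c u + d v\<close>.
\<close>

lemma norm_rotation_le:
  fixes a b :: 'k
  assumes "c\<^sup>2 + d\<^sup>2 = (1::real)"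
  shows "(norm (of_real c * a + of_real d * b))\<^sup>2 \<le> (norm a)\<^sup>2 + (norm b)\<^sup>2"
proof -
  have "norm (of_real c * a + of_real d * b) \<le> \<bar>c\<bar> * norm a + \<bar>d\<bar> * norm b"
    by (rule order_trans[OF norm_triangle_ineq]) (simp add: norm_mult)
  then have "(norm (of_real c * a + of_real d * b))\<^sup>2 \<le> (\<bar>c\<bar> * norm a + \<bar>d\<bar> * norm b)\<^sup>2"
    by (intro power_mono) auto
  also have "\<dots> \<le> (\<bar>c\<bar> * norm a + \<bar>d\<bar> * norm b)\<^sup>2 + (\<bar>d\<bar> * norm a - \<bar>c\<bar> * norm b)\<^sup>2"
    by simp
  also have "\<dots> = (c\<^sup>2 + d\<^sup>2) * ((norm a)\<^sup>2 + (norm b)\<^sup>2)"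
    by (simp add: power2_eq_square algebra_simps)
  finally show ?thesis using assms by simp
qed

text \<open>
  The two arguments of the minimum come from the two cases. Let \<open>u\<close> be the vector extracted at \<open>e\<close> and
  \<open>t = \<parallel>u\<parallel>\<^sup>2 \<le> M\<close>. If \<open>t \<ge> \<alpha>\<close>, the multiple of \<open>u\<close> with square norm \<open>\<alpha>\<close> removes
  the fraction \<open>\<alpha> / t \<ge> \<alpha> / M\<close> of the form at \<open>e\<close>. If \<open>t < \<alpha>\<close>, the vector is rotated towards a long
  vector \<open>v\<close>; the fraction that is left behind is the weight of \<open>v\<close>, at most \<open>\<alpha> / \<beta>\<close>, and
  \<open>\<alpha> \<le> s\<close> gives \<open>1 - \<alpha> / \<beta> \<ge> (1 / s - 1 / \<beta>) \<alpha>\<close>.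
\<close>

lemma extraction_step:
  assumes A: "positive_operator scl ip A"
    and M: "\<And>x. quad A x \<le> M * (norm x)\<^sup>2" and "0 < M"
    and ess: "essentially_above \<beta> A"
    and \<alpha>: "0 < \<alpha>" "\<alpha> \<le> s" and s: "s < \<beta>"
  obtains z where "(norm z)\<^sup>2 = \<alpha>" "\<And>x. (norm (ip x z))\<^sup>2 \<le> quad A x"
    "min (1 / M) (1 / s - 1 / \<beta>) * \<alpha> * quad A e \<le> (norm (ip e z))\<^sup>2"
proof -
  let ?c = "min (1 / M) (1 / s - 1 / \<beta>)"
  define u where "u = extracted_vector A e"
  define t where "t = (norm u)\<^sup>2"
  have t0: "0 \<le> t" by (simp add: t_def)
  have ue: "(norm (ip e u))\<^sup>2 = quad A e"
    unfolding u_def by (rule extracted_vector_eq[OF A])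
  have ule: "(norm (ip x u))\<^sup>2 \<le> quad A x" for x
    unfolding u_def by (rule extracted_vector_le[OF A])
  show ?thesis
  proof (cases "\<alpha> \<le> t")
    case True
    define z where "z = sqrt (\<alpha> / t) *\<^sub>R u"
    have t: "0 < t" using True \<alpha> by simp
    have tM: "t \<le> M"
    proof -
      have "quad A e \<noteq> 0"
        using t by (auto simp: t_def u_def norm_extracted_vector)
      then have "quad A e > 0" using quad_nonneg[of A e] by linarith
      then show ?thesis
        using norm_sq_le_quad[OF A M, of e]
        by (simp add: t_def u_def norm_extracted_vector divide_le_eq)
    qed
    have zx: "(norm (ip x z))\<^sup>2 = \<alpha> / t * (norm (ip x u))\<^sup>2" for x
      using t \<alpha> by (simp add: z_def ip_scaleR_right norm_mult power_mult_distrib)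
    show ?thesis
    proof (rule that[of z])
      show "(norm z)\<^sup>2 = \<alpha>"
        using t \<alpha> by (simp add: z_def power_mult_distrib t_def[symmetric])
      show "(norm (ip x z))\<^sup>2 \<le> quad A x" for x
      proof -
        have "\<alpha> / t * (norm (ip x u))\<^sup>2 \<le> 1 * (norm (ip x u))\<^sup>2"
          using True t by (intro mult_right_mono) auto
        then show ?thesis using ule[of x] zx[of x] by simp
      qed
      have "?c \<le> 1 / t"
        using frac_le[of 1 1 t M] t tM by simp
      then have "?c * \<alpha> \<le> 1 / t * \<alpha>" using \<alpha> by (intro mult_right_mono) auto
      then have "?c * \<alpha> \<le> \<alpha> / t" by simp
      then show "?c * \<alpha> * quad A e \<le> (norm (ip e z))\<^sup>2"
        unfolding zx ue by (intro mult_right_mono) auto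
    qed
  next
    case False
    let ?A1 = "\<lambda>x. A x - rank_one u u x"
    note A1 = rank_one_le_imp_positive_diff[OF A ule]
    obtain v where v: "ip u v = 0" "\<beta> < (norm v)\<^sup>2" "\<And>x. (norm (ip x v))\<^sup>2 \<le> quad ?A1 x"
      using extract_long_vector[OF A1(1) essentially_above_diff_rank_one[OF ess]] \<alpha> s
      by (metis less_imp_le less_trans order_less_le_trans)
    define V where "V = (norm v)\<^sup>2"
    have V: "\<alpha> < V" "s < V" "\<beta> < V" "t < V" "0 < V"
      using v(2) \<alpha> s False t0 by (auto simp: V_def)
    \<comment> \<open>The form of \<open>A - u u\<^sup>*\<close> vanishes at \<open>e\<close> and dominates \<open>v v\<^sup>*\<close>.\<close>
    have ev: "ip e v = 0"
      using v(3)[of e] by (simp add: A1(2) ue)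
    \<comment> \<open>The square of the sine: the weight of \<open>v\<close> that brings the square norm from \<open>t\<close> up to \<open>\<alpha>\<close>.\<close>
    define d2 where "d2 = (\<alpha> - t) / (V - t)"
    have "d2 * (V - t) = \<alpha> - t" using V by (simp add: d2_def)
    moreover have "(1 - d2) * t + d2 * V = t + d2 * (V - t)" by (simp add: algebra_simps)
    ultimately have d2_combination: "(1 - d2) * t + d2 * V = \<alpha>" by linarith
    have d2: "0 \<le> d2" "d2 \<le> 1"
      unfolding d2_def using V False by (auto intro: divide_nonneg_pos simp only: divide_le_eq_1_pos diff_gt_0_iff_gt)
    have "d2 \<le> \<alpha> / V"
    proof -
      have "t * (V - \<alpha>) \<ge> 0" using V t0 by simp
      then show ?thesis unfolding d2_def using V by (simp add: field_simps)
    qed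
    also have "\<dots> \<le> \<alpha> / \<beta>" using V \<alpha> s by (intro divide_left_mono) auto
    also have "\<dots> \<le> 1 - ?c * \<alpha>"
    proof -
      have "?c * \<alpha> \<le> (1 / s - 1 / \<beta>) * \<alpha>" using \<alpha> by (intro mult_right_mono) auto
      also have "\<dots> = \<alpha> / s - \<alpha> / \<beta>" by (simp add: algebra_simps)
      also have "\<dots> \<le> 1 - \<alpha> / \<beta>" using \<alpha> by simp
      finally show ?thesis by simp
    qed
    finally have d2c: "?c * \<alpha> \<le> 1 - d2" by simp
    define z where "z = sqrt (1 - d2) *\<^sub>R u + sqrt d2 *\<^sub>R v"
    have zx: "ip x z = of_real (sqrt (1 - d2)) * ip x u + of_real (sqrt d2) * ip x v" for x
      by (simp add: z_def ip_add_right ip_scaleR_right)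
    show ?thesis
    proof (rule that[of z])
      show "(norm z)\<^sup>2 = \<alpha>"
        unfolding z_def norm_orthogonal_combination[OF v(1)]
        using d2 d2_combination by (simp add: t_def[symmetric] V_def[symmetric])
      show "(norm (ip x z))\<^sup>2 \<le> quad A x" for x
      proof -
        have "(norm (ip x z))\<^sup>2 \<le> (norm (ip x u))\<^sup>2 + (norm (ip x v))\<^sup>2"
          unfolding zx using d2 by (intro norm_rotation_le) simp
        then show ?thesis using v(3)[of x] by (simp add: A1(2))
      qed
      have "(norm (ip e z))\<^sup>2 = (1 - d2) * quad A e"
        unfolding zx using d2 by (simp add: ev norm_mult power_mult_distrib ue)
      then show "?c * \<alpha> * quad A e \<le> (norm (ip e z))\<^sup>2"
        using d2c by (simp add: mult_right_mono)
    qed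
  qed
qed

end

section \<open>Scheduling a divergent series\<close>

lemma not_summable_imp_large_blocks:
  fixes \<alpha> :: "nat \<Rightarrow> real"
  assumes "\<not> summable \<alpha>" and "\<And>i. 0 \<le> \<alpha> i"
  shows "\<exists>n>m. 1 \<le> sum \<alpha> {m..<n}"
proof (rule ccontr)
  assume "\<not> ?thesis"
  then have small: "sum \<alpha> {m..<n} \<le> 1" if "m < n" for n
    using that by force
  have "sum (\<lambda>i. norm (\<alpha> i)) {..<n} \<le> sum \<alpha> {..<m} + 1" for n
  proof -
    have "sum \<alpha> {..<n} \<le> sum \<alpha> {..<m} + sum \<alpha> {m..<max n (Suc m)}"
      using sum.atLeastLessThan_concat[of 0 m "max n (Suc m)" \<alpha>]
        sum_mono2[of "{..<max n (Suc m)}" "{..<n}" \<alpha>] assms(2)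
      by (simp add: atLeast0LessThan lessThan_subset_iff)
    moreover have "m < max n (Suc m)" by simp
    ultimately show ?thesis using small[of "max n (Suc m)"] assms(2) by force
  qed
  then have "summable (\<lambda>i. norm (\<alpha> i))"
    by (intro summableI_nonneg_bounded) auto
  then show False using assms(1) summable_norm_cancel by blast
qed

text \<open>
  Cut the series into consecutive blocks of sum at least \<open>1\<close>, and assign the blocks to the indices so that every
  index receives infinitely many; the first component of the inverse pairing function does that.
\<close>

lemma not_summable_split:
  fixes \<alpha> :: "nat \<Rightarrow> real"
  assumes ns: "\<not> summable \<alpha>" and nn: "\<And>i. 0 \<le> \<alpha> i"
  shows "\<exists>k :: nat \<Rightarrow> nat. \<forall>j. \<not> summable (\<lambda>n. if k n = j then \<alpha> n else 0)"
proof -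
  have "\<exists>N. \<forall>i. True \<and> (N i < N (Suc i) \<and> 1 \<le> sum \<alpha> {N i..<N (Suc i)})"
    by (rule dependent_nat_choice) (use not_summable_imp_large_blocks[OF ns nn] in auto)
  then obtain N :: "nat \<Rightarrow> nat"
    where N: "\<And>i. N i < N (Suc i)" "\<And>i. 1 \<le> sum \<alpha> {N i..<N (Suc i)}" by blast
  have mono: "strict_mono N" using N(1) by (simp add: strict_mono_Suc_iff)
  define block where "block n = (LEAST b. n < N (Suc b))" for n
  have block: "block n = b" if "N b \<le> n" "n < N (Suc b)" for n b
    unfolding block_def
  proof (rule Least_equality)
    fix b' assume "n < N (Suc b')"
    then have "N b < N (Suc b')" using that(1) by simp
    then show "b \<le> b'" using mono by (simp add: strict_mono_less)
  qed (use that in simp)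
  define k where "k n = fst (prod_decode (block n))" for n
  have "\<not> summable (\<lambda>n. if k n = j then \<alpha> n else 0)" (is "\<not> summable ?f") for j
  proof
    assume "summable ?f"
    then obtain m where m: "\<And>p q. m \<le> p \<Longrightarrow> norm (sum ?f {p..<q}) < 1"
      unfolding summable_Cauchy by (metis zero_less_one)
    \<comment> \<open>A block assigned to \<open>j\<close> that starts beyond \<open>m\<close>.\<close>
    define b where "b = prod_encode (j, m)"
    have "m \<le> N b"
      using le_prod_encode_2[of m j] strict_mono_imp_increasing[OF mono, of b] by (simp add: b_def)
    moreover have "sum ?f {N b..<N (Suc b)} = sum \<alpha> {N b..<N (Suc b)}"
      by (rule sum.cong) (auto simp: k_def block b_def)
    ultimately show False using m[of "N b" "N (Suc b)"] N(2)[of b] by simp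
  qed
  then show ?thesis by blast
qed

text \<open>
  The decreasing sequence \<open>f\<close> has a limit \<open>L\<close>. If \<open>L > 0\<close>, its decrements are at least \<open>c L w\<^sub>n\<close>,
  but they form a convergent telescoping series.
\<close>

lemma contraction_tendsto_zero:
  fixes f w :: "nat \<Rightarrow> real"
  assumes f: "\<And>n. 0 \<le> f n" "\<And>n. f (Suc n) \<le> (1 - c * w n) * f n"
    and w: "\<not> summable w" "\<And>n. 0 \<le> w n" and "0 < c"
  shows "f \<longlonglongrightarrow> 0"
proof -
  have step: "c * w n * f n \<le> f n - f (Suc n)" for n
    using f(2)[of n] by (simp add: algebra_simps)
  have "0 \<le> c * w n * f n" for n using f(1) w(2) \<open>0 < c\<close> by simp
  then have "decseq f"
    using step by (intro decseq_SucI) (metis diff_ge_0_iff_ge order_trans)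
  then obtain L where L: "f \<longlonglongrightarrow> L" "\<And>n. L \<le> f n"
    using decseq_convergent[of f 0] f(1) by blast
  have "0 \<le> L" using L(1) f(1) by (intro LIMSEQ_le_const) auto
  moreover have "\<not> 0 < L"
  proof
    assume "0 < L"
    have "c * L * w n \<le> f n - f (Suc n)" for n
    proof -
      have "c * w n * L \<le> c * w n * f n"
        using w(2) \<open>0 < c\<close> L(2) by (intro mult_left_mono) auto
      then show ?thesis using step[of n] by (simp add: mult_ac)
    qed
    moreover have "summable (\<lambda>n. f n - f (Suc n))" by (rule telescope_summable'[OF L(1)])
    ultimately have "summable (\<lambda>n. c * L * w n)"
      using w(2) \<open>0 < c\<close> \<open>0 < L\<close>
      by (intro summable_comparison_test[of "\<lambda>n. c * L * w n"]) auto
    then show False using w(1) \<open>0 < c\<close> \<open>0 < L\<close> by (simp add: summable_cmult_iff)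
  qed
  ultimately show ?thesis using L(1) by simp
qed

section \<open>Decomposition into rank-one operators and frames\<close>

context hilbert_space
begin

text \<open>
  \<open>A n\<close> is the residual after \<open>n\<close> extractions, and \<open>e (k n)\<close> is the vector whose form is diminished at step
  \<open>n\<close>. The forms decrease at all other vectors too, so the progress made for one member of the
  dense sequence is never lost while others are treated.
\<close>

theorem rank_one_decomposition:
  fixes e :: "nat \<Rightarrow> 'v"
  assumes B: "positive_operator scl ip B"
    and M: "\<And>x. quad B x \<le> M * (norm x)\<^sup>2" "0 < M"
    and ess: "essentially_above \<beta> B"
    and \<alpha>: "\<And>n. 0 < \<alpha> n" "\<And>n. \<alpha> n \<le> s" "\<not> summable \<alpha>" and s: "s < \<beta>"
    and dense: "closure (range e) = UNIV"
  shows "\<exists>z :: nat \<Rightarrow> 'v. (\<forall>n. (norm (z n))\<^sup>2 = \<alpha> n) \<and> (\<forall>x. (\<lambda>n. rank_one (z n) (z n) x) sums B x)"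
proof -
  let ?c = "min (1 / M) (1 / s - 1 / \<beta>)"
  have "0 < s" using \<alpha>(1,2)[of 0] by linarith
  then have "1 / \<beta> < 1 / s" using s by (intro divide_strict_left_mono) simp_all
  then have c: "0 < ?c" using M(2) by simp
  obtain k :: "nat \<Rightarrow> nat" where k: "\<forall>j. \<not> summable (\<lambda>n. if k n = j then \<alpha> n else 0)"
    using not_summable_split[OF \<alpha>(3) less_imp_le[OF \<alpha>(1)]] ..
  let ?P = "\<lambda>n A. (n = (0::nat) \<longrightarrow> A = B) \<and> positive_operator scl ip A \<and>
      (\<forall>x. quad A x \<le> M * (norm x)\<^sup>2) \<and> essentially_above \<beta> A"
  let ?R = "\<lambda>n A A' z. (norm z)\<^sup>2 = \<alpha> n \<and> A' = (\<lambda>x. A x - rank_one z z x) \<and>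
      (\<forall>x. quad A' x = quad A x - (norm (ip x z))\<^sup>2) \<and>
      ?c * \<alpha> n * quad A (e (k n)) \<le> (norm (ip (e (k n)) z))\<^sup>2"
  have "\<exists>A. \<forall>n. ?P n (A n) \<and> (\<exists>z. ?R n (A n) (A (Suc n)) z)"
  proof (rule dependent_nat_choice)
    show "\<exists>A. ?P 0 A" by (rule exI[of _ B]) (use B M ess in simp)
    fix A n assume "?P n A"
    then have A: "positive_operator scl ip A" "\<And>x. quad A x \<le> M * (norm x)\<^sup>2" "essentially_above \<beta> A"
      by auto
    obtain z where z: "(norm z)\<^sup>2 = \<alpha> n" "\<And>x. (norm (ip x z))\<^sup>2 \<le> quad A x"
      "?c * \<alpha> n * quad A (e (k n)) \<le> (norm (ip (e (k n)) z))\<^sup>2"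
      using extraction_step[OF A(1,2) M(2) A(3) \<alpha>(1,2) s] by blast
    let ?A' = "\<lambda>x. A x - rank_one z z x"
    note A' = rank_one_le_imp_positive_diff[OF A(1) z(2)]
    have "quad ?A' x \<le> M * (norm x)\<^sup>2" for x
      unfolding A'(2) using A(2)[of x] by (rule order_trans[rotated]) simp
    then have "?P (Suc n) ?A'" using A'(1) essentially_above_diff_rank_one[OF A(3)] by simp
    moreover have "?R n A ?A' z" using z A'(2) by simp
    ultimately show "\<exists>A'. ?P (Suc n) A' \<and> (\<exists>z. ?R n A A' z)"
      by (intro exI[of _ ?A'] conjI exI[of _ z]) simp_all
  qed
  then obtain A where A: "\<forall>n. ?P n (A n) \<and> (\<exists>z. ?R n (A n) (A (Suc n)) z)" ..
  then have "\<forall>n. \<exists>z. ?R n (A n) (A (Suc n)) z" by (rule all_forward) (rule conjunct2)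
  from choice[OF this] obtain z where "\<forall>n. ?R n (A n) (A (Suc n)) (z n)" ..
  then have z: "(norm (z n))\<^sup>2 = \<alpha> n" "A (Suc n) = (\<lambda>x. A n x - rank_one (z n) (z n) x)"
    "quad (A (Suc n)) x = quad (A n) x - (norm (ip x (z n)))\<^sup>2"
    "?c * \<alpha> n * quad (A n) (e (k n)) \<le> (norm (ip (e (k n)) (z n)))\<^sup>2" for n x
    by blast+
  have pos: "positive_operator scl ip (A n)" and AM: "quad (A n) x \<le> M * (norm x)\<^sup>2" for n x
    using spec[OF A, of n] by auto
  have An: "norm (A n x) \<le> M * norm x" for n x
  proof -
    have "(norm (A n x))\<^sup>2 \<le> M * (M * (norm x)\<^sup>2)"
      by (rule order_trans[OF norm_sq_le_quad[OF pos AM] mult_left_mono[OF AM]]) (use M in simp)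
    then have "(norm (A n x))\<^sup>2 \<le> (M * norm x)\<^sup>2" by (simp add: power2_eq_square mult_ac)
    then show ?thesis by (rule power2_le_imp_le) (use M(2) in simp)
  qed
  have quad_e: "(\<lambda>n. quad (A n) (e j)) \<longlonglongrightarrow> 0" for j
  proof (rule contraction_tendsto_zero[OF _ _ spec[OF k, of j] _ c])
    show "quad (A (Suc n)) (e j) \<le> (1 - ?c * (if k n = j then \<alpha> n else 0)) * quad (A n) (e j)" for n
      using z(4)[of n] by (auto simp: z(3) left_diff_distrib)
  qed (use \<alpha>(1) less_imp_le in auto)
  have A_e: "(\<lambda>n. A n (e j)) \<longlonglongrightarrow> 0" for j
  proof -
    have "(\<lambda>n. (norm (A n (e j)))\<^sup>2) \<longlonglongrightarrow> 0"
    proof (rule tendsto_sandwich[OF _ _ tendsto_const])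
      show "(\<lambda>n. M * quad (A n) (e j)) \<longlonglongrightarrow> 0"
        using tendsto_mult_right_zero[OF quad_e] by blast
    qed (use norm_sq_le_quad[OF pos AM] in auto)
    then have "(\<lambda>n. sqrt ((norm (A n (e j)))\<^sup>2)) \<longlonglongrightarrow> sqrt 0" by (rule tendsto_real_sqrt)
    then show ?thesis by (simp add: tendsto_norm_zero_iff)
  qed
  have A_lim: "(\<lambda>n. A n x) \<longlonglongrightarrow> 0" for x
  proof (rule LIMSEQ_I)
    fix r :: real assume r: "0 < r"
    have "x \<in> closure (range e)" using dense by simp
    moreover have "0 < r / (2 * M)" using r M(2) by simp
    ultimately obtain j where j: "dist (e j) x < r / (2 * M)"
      unfolding closure_approachable by blast
    obtain N where N: "\<And>n. n \<ge> N \<Longrightarrow> norm (A n (e j)) < r / 2"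
      using LIMSEQ_D[OF A_e[of j], of "r / 2"] r by auto
    have "norm (A n x) < r" if "n \<ge> N" for n
    proof -
      have "A n x = A n (e j) + A n (x - e j)"
        using linear_add[OF bounded_linear.linear[OF positive_operatorD(1)[OF pos]], of n "e j" "x - e j"]
        by simp
      then have "norm (A n x) \<le> norm (A n (e j)) + norm (A n (x - e j))"
        by (simp add: norm_triangle_ineq)
      moreover have "norm (A n (x - e j)) \<le> M * norm (x - e j)" by (rule An)
      moreover have "M * norm (x - e j) < r / 2"
        using j M(2) by (simp add: dist_norm norm_minus_commute field_simps)
      ultimately show ?thesis using N[OF that] by simp
    qed
    then show "\<exists>N. \<forall>n\<ge>N. norm (A n x - 0) < r" by auto
  qed
  have "(\<lambda>n. rank_one (z n) (z n) x) sums B x" for x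
  proof -
    have "(\<Sum>i<n. rank_one (z i) (z i) x) = B x - A n x" for n
    proof (induction n)
      case 0 then show ?case using spec[OF A, of 0] by simp
    next
      case (Suc n)
      have "A (Suc n) x = A n x - rank_one (z n) (z n) x" by (rule fun_cong[OF z(2)])
      then show ?case using Suc by simp
    qed
    then show ?thesis
      unfolding sums_def using tendsto_diff[OF tendsto_const A_lim[of x], of "B x"] by simp
  qed
  then show ?thesis using z(1) by (intro exI[of _ z]) simp
qed

text \<open>Pair the series that defines the frame operator with \<open>x\<close>.\<close>

lemma frame_operator_imp_sums_quad:
  assumes "has_frame_operator scl ip z S" and S: "positive_operator scl ip S"
  shows "(\<lambda>i. (norm (ip x (z i)))\<^sup>2) sums quad S x"
proof -
  have "bounded_linear (\<lambda>y. ip y x)"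
    by (rule bounded_linear_intro[where K = "norm x"])
      (simp_all add: ip_add_left ip_scaleR_left scaleR_conv_of_real Cauchy_Schwarz)
  moreover have "(\<lambda>i. scl (ip x (z i)) (z i)) sums S x"
    using assms(1) by (simp add: has_frame_operator_def)
  ultimately have "(\<lambda>i. ip (scl (ip x (z i)) (z i)) x) sums ip (S x) x"
    by (rule bounded_linear.sums)
  then show ?thesis
    unfolding ip_scale_left ip_mult_commute ip_eq_quad[OF S] sums_of_real_iff .
qed

text \<open>
  The frame sum at \<open>x\<close> is \<open>\<langle>S x, x\<rangle>\<close>. It is bounded below because
  \<open>\<parallel>x\<parallel>\<^sup>2 \<le> \<parallel>S\<^sup>-\<^sup>1\<parallel>\<^sup>2 \<parallel>S x\<parallel>\<^sup>2\<close>, and \<open>\<parallel>S x\<parallel>\<^sup>2\<close> is at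
  most a constant times \<open>\<langle>S x, x\<rangle>\<close>.
\<close>

lemma frame_operator_imp_is_frame:
  assumes z: "has_frame_operator scl ip z S" and S: "positive_operator scl ip S"
    and inv: "invertible_operator scl S"
  shows "is_frame ip z"
proof -
  obtain R where R: "bounded_operator scl R" "R \<circ> S = id"
    using inv by (auto simp: invertible_operator_def)
  obtain K where K: "0 < K" "\<And>x. norm (R x) \<le> norm x * K"
    using R(1) bounded_linear.pos_bounded unfolding bounded_operator_def by blast
  obtain M where M: "0 < M" "\<And>x. quad S x \<le> M * (norm x)\<^sup>2"
    using quad_bounded[OF S] by blast
  have low: "(norm x)\<^sup>2 \<le> K\<^sup>2 * M * quad S x" for x
  proof -
    have "R (S x) = x" using R(2) by (metis comp_apply id_apply)
    then have "(norm x)\<^sup>2 \<le> (norm (S x) * K)\<^sup>2"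
      using K(2)[of "S x"] by (intro power_mono) auto
    also have "\<dots> = K\<^sup>2 * (norm (S x))\<^sup>2" by (simp add: power_mult_distrib)
    also have "\<dots> \<le> K\<^sup>2 * (M * quad S x)"
      by (intro mult_left_mono norm_sq_le_quad[OF S M(2)]) simp
    finally show ?thesis by (simp add: mult.assoc)
  qed
  \<comment> \<open>The maximum only ensures \<open>C \<le> D\<close>, also on the zero space.\<close>
  let ?C = "1 / (K\<^sup>2 * M)" and ?D = "max M (1 / (K\<^sup>2 * M))"
  have "summable (\<lambda>i. (norm (ip x (z i)))\<^sup>2) \<and>
      ?C * (norm x)\<^sup>2 \<le> (\<Sum>i. (norm (ip x (z i)))\<^sup>2) \<and>
      (\<Sum>i. (norm (ip x (z i)))\<^sup>2) \<le> ?D * (norm x)\<^sup>2" for x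
  proof -
    have sm: "(\<lambda>i. (norm (ip x (z i)))\<^sup>2) sums quad S x"
      by (rule frame_operator_imp_sums_quad[OF z S])
    have "?C * (norm x)\<^sup>2 \<le> quad S x"
      using low[of x] K(1) M(1) by (simp add: divide_le_eq mult.commute)
    moreover have "quad S x \<le> ?D * (norm x)\<^sup>2"
      by (rule order_trans[OF M(2)]) (simp add: mult_right_mono)
    ultimately show ?thesis using sums_unique[OF sm] sums_summable[OF sm] by simp
  qed
  moreover have "0 < ?C" using K(1) M(1) by simp
  ultimately show ?thesis unfolding is_frame_def by (intro exI[of _ ?C] exI[of _ ?D]) auto
qed

lemma less_essential_norm_imp_essentially_above:
  assumes A: "bounded_operator scl A" and "\<beta> < essential_norm scl A"
  shows "essentially_above \<beta> A"
  unfolding essentially_above_def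
proof (intro allI impI)
  fix K assume K: "compact_operator scl K"
  have "bdd_below {onorm (\<lambda>x. A x - K x) |K. compact_operator scl K}"
    using A by (intro bdd_belowI[of _ 0])
      (auto simp: compact_operator_def bounded_operator_def intro!: onorm_pos_le bounded_linear_sub)
  then have "essential_norm scl A \<le> onorm (\<lambda>x. A x - K x)"
    unfolding essential_norm_def using K by (intro cInf_lower) auto
  then show "\<beta> < onorm (\<lambda>x. A x - K x)" using assms(2) by simp
qed

end

theorem corollary12:
  fixes scl :: "'k::real_or_complex \<Rightarrow> 'v::banach \<Rightarrow> 'v"
    and ip :: "'v \<Rightarrow> 'v \<Rightarrow> 'k"
    and B :: "'v \<Rightarrow> 'v"
    and a :: "nat \<Rightarrow> real"
  assumes "hilbert_space scl ip"
    and "separable_space (euclidean :: 'v topology)"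
    and "infinite_dimensional scl"
    and "positive_operator scl ip B"
    and "invertible_operator scl B"
    and "\<And>i. 0 < a i"
    and "(\<Sum>i. ereal ((a i)\<^sup>2)) = \<infinity>"
    and "(SUP i. ereal ((a i)\<^sup>2)) < ereal (essential_norm scl B)"
  shows "\<exists>z :: nat \<Rightarrow> 'v. is_frame ip z \<and> has_frame_operator scl ip z B \<and> (\<forall>i. norm (z i) = a i)"
proof -
  interpret hilbert_space scl ip by fact
  obtain \<beta> where \<beta>: "(SUP i. ereal ((a i)\<^sup>2)) < ereal \<beta>" "\<beta> < essential_norm scl B"
    using ereal_dense2[OF assms(8)] by auto
  obtain s where s: "(SUP i. ereal ((a i)\<^sup>2)) < ereal s" "s < \<beta>"
    using ereal_dense2[OF \<beta>(1)] by auto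
  have as: "(a i)\<^sup>2 \<le> s" for i
    using order_trans[OF SUP_upper[of i UNIV "\<lambda>i. ereal ((a i)\<^sup>2)"] less_imp_le[OF s(1)]] by simp
  have ns: "\<not> summable (\<lambda>i. (a i)\<^sup>2)"
  proof
    assume "summable (\<lambda>i. (a i)\<^sup>2)"
    then have "(\<Sum>i. ereal ((a i)\<^sup>2)) = ereal (\<Sum>i. (a i)\<^sup>2)"
      by (simp add: sums_unique[symmetric] sums_ereal summable_sums)
    then show False using assms(7) by simp
  qed
  obtain C :: "'v set" where C: "countable C" "closure C = UNIV"
    using assms(2) by (auto simp: separable_space_def)
  then have "C \<noteq> {}" by auto
  then have dense: "closure (range (from_nat_into C)) = UNIV"
    using C by (simp add: range_from_nat_into)
  have bo: "bounded_operator scl B" using assms(4) by (simp add: positive_operator_def)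
  obtain M where M: "0 < M" "\<And>x. quad B x \<le> M * (norm x)\<^sup>2"
    using quad_bounded[OF assms(4)] by blast
  have "0 < (a n)\<^sup>2" for n using assms(6)[of n] by simp
  from rank_one_decomposition[OF assms(4) M(2,1)
      less_essential_norm_imp_essentially_above[OF bo \<beta>(2)] this as ns s(2) dense]
  obtain z where z: "\<forall>n. (norm (z n))\<^sup>2 = (a n)\<^sup>2" "\<forall>x. (\<lambda>n. rank_one (z n) (z n) x) sums B x"
    by (elim exE conjE)
  have op: "has_frame_operator scl ip z B"
    using z(2) by (simp add: has_frame_operator_def rank_one_def)
  have "norm (z i) = a i" for i
    using spec[OF z(1), of i] less_imp_le[OF assms(6)[of i]] by simp
  then show ?thesis
    using op frame_operator_imp_is_frame[OF op assms(4,5)] by blast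
qed

end
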